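(* Let $p>0$. For all $x>0$, $$\lim_{m\to -1^+}x^{p-1}V_m^p(x)=1.$$
   Context: For real $p>0$, real $m>-1$ and $x>0$, $V_m^p(x)=\frac{p e^{x^p}}{\Gamma(m+1)}\int_x^\infty (t^p-x^p)^m e^{-t^p}\,dt=\frac{1}{\Gamma(m+1)}\int_0^\infty \frac{u^m e^{-u}}{(x^p+u)^{(p-1)/p}}\,du$. *)

theory Defs
  imports "HOL-Analysis.Analysis"
begin

text \<open>
  The function \<open>V\<^sub>m\<^sup>p(x)\<close>, meaningful for \<open>p > 0\<close>, \<open>m > -1\<close>, \<open>x > 0\<close>; in this range the integrand
  is nonnegative and Lebesgue integrable on \<open>(x, \<infinity>)\<close>, with a possible singularity at \<open>t = x\<close> if \<open>m < 0\<close>.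
\<close>

definition V :: "real \<Rightarrow> real \<Rightarrow> real \<Rightarrow> real" where
  "V m p x = p * exp (x powr p) / Gamma (m + 1) *
     (LBINT t:{x<..}. (t powr p - x powr p) powr m * exp (- (t powr p)))"

end

theory Submission imports Defs begin

text \<open>
  Put \<open>a = x\<^sup>p\<close> and \<open>s = m + 1\<close>. The substitution \<open>u = t\<^sup>p - a\<close> turns \<open>x\<^sup>p\<^sup>-\<^sup>1 V\<^sub>m\<^sup>p(x)\<close> into
  the mean of \<open>h(u) = (1 + u/a)\<^bsup>1/p - 1\<^esup>\<close> with respect to the Gamma distribution
  \<open>u\<^bsup>s - 1\<^esup> e\<^bsup>-u\<^esup> du / \<Gamma>(s)\<close> on \<open>(0, \<infinity>)\<close> (lemma \<open>V_eq_gamma_mean\<close>). As \<open>s\<close> decreases to \<open>0\<close>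
  these distributions concentrate at the origin, so the mean tends to \<open>h(0) = 1\<close>.

  The concentration is proved with an explicit error. If
  \<open>\<bar>h(u) - L\<bar> \<le> C u e\<^bsup>cu\<^esup>\<close> with \<open>c < 1\<close>, the factor \<open>u\<close> cancels the singularity of \<open>u\<^bsup>s - 1\<^esup>\<close>, and
  the unnormalised integral of \<open>h - L\<close> stays bounded uniformly in \<open>0 < s \<le> 1\<close>
  (lemma \<open>gamma_integral_deviation\<close>). Dividing by \<open>\<Gamma>(s)\<close>, which tends to infinity, gives the limit.
  For the power \<open>h\<close> above, such a bound follows from the mean value theorem
  (lemma \<open>powr_deviation_le_exp\<close>).
\<close>

section \<open>Growth bounds\<close>

text \<open>
  Used to absorb polynomial factors into an exponential of arbitrarily small rate.
\<close>

lemma one_plus_le_exp_div: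
  fixes d y :: real
  assumes "0 < d" "d \<le> 1"
  shows "1 + y \<le> exp (d * y) / d"
proof -
  have "d * (1 + y) \<le> 1 + d * y"
    using assms by (simp add: algebra_simps)
  also have "\<dots> \<le> exp (d * y)"
    by (rule exp_ge_add_one_self)
  finally show ?thesis
    using assms by (simp add: field_simps)
qed

text \<open>
  The mean value theorem produces the factor \<open>u\<close>; the derivative grows polynomially, hence more
  slowly than \<open>exp (c * u)\<close>.
\<close>

lemma powr_deviation_le_exp:
  fixes a c r :: real
  assumes a: "a > 0" and c: "c > 0"
  shows "\<exists>C\<ge>0. \<forall>u>0. \<bar>(1 + u / a) powr r - 1\<bar> \<le> C * u * exp (c * u)"
proof -
  define k where "k = \<bar>r - 1\<bar>"
  \<comment> \<open>With this rate, raising \<open>1 + y \<le> exp (d * y) / d\<close> to the power \<open>k\<close> costs at most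
    \<open>exp (c * a * y)\<close>, which is \<open>exp (c * u)\<close> for \<open>y = u / a\<close>.\<close>
  define d where "d = min 1 (c * a / (k + 1))"
  define C where "C = \<bar>r\<bar> / a * d powr (- k)"
  have k: "k \<ge> 0" by (simp add: k_def)
  have d: "0 < d" "d \<le> 1" using a c k by (auto simp: d_def)
  have "d * k \<le> d * (k + 1)" using d by simp
  also have "\<dots> \<le> c * a / (k + 1) * (k + 1)"
    using k by (intro mult_right_mono) (auto simp: d_def)
  also have "\<dots> = c * a" using k by simp
  finally have dk: "d * k \<le> c * a" .
  have "\<bar>(1 + u / a) powr r - 1\<bar> \<le> C * u * exp (c * u)" if u: "u > 0" for u
  proof -
    define y where "y = u / a"
    have y: "y > 0" using u a by (simp add: y_def)
    have "\<exists>z>0. z < y \<and> (1 + y) powr r - (1 + 0) powr r = (y - 0) * (r * (1 + z) powr (r - 1))"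
      by (rule MVT2[OF y]) (auto intro!: derivative_eq_intros)
    then obtain z where z: "0 < z" "z < y"
      and eq: "(1 + y) powr r - 1 = y * (r * (1 + z) powr (r - 1))"
      by auto
    have "(1 + z) powr (r - 1) \<le> (1 + z) powr k"
      using z by (intro powr_mono) (auto simp: k_def)
    also have "\<dots> \<le> (1 + y) powr k"
      using z k by (intro powr_mono2) auto
    also have "\<dots> \<le> (exp (d * y) / d) powr k"
      using y k one_plus_le_exp_div[OF d, of y] by (intro powr_mono2) auto
    also have "\<dots> = exp (d * k * y) * d powr (- k)"
      using d by (subst powr_divide) (simp_all add: exp_powr_real powr_minus divide_inverse mult_ac)
    also have "\<dots> \<le> exp (c * a * y) * d powr (- k)"
      using dk y by (intro mult_right_mono) auto
    also have "c * a * y = c * u" using a by (simp add: y_def)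
    finally have le: "(1 + z) powr (r - 1) \<le> exp (c * u) * d powr (- k)" .
    have "\<bar>(1 + y) powr r - 1\<bar> = y * \<bar>r\<bar> * (1 + z) powr (r - 1)"
      using y by (simp add: eq abs_mult)
    also have "\<dots> \<le> y * \<bar>r\<bar> * (exp (c * u) * d powr (- k))"
      using y le by (intro mult_left_mono) auto
    also have "\<dots> = C * u * exp (c * u)"
      by (simp add: C_def y_def)
    finally show ?thesis by (simp add: y_def)
  qed
  moreover have "C \<ge> 0" using a by (simp add: C_def)
  ultimately show ?thesis by blast
qed

section \<open>Concentration of the Gamma distribution at the origin\<close>

lemma has_integral_atLeast_iff_greaterThan:
  fixes f :: "real \<Rightarrow> real"
  shows "(f has_integral I) {c..} \<longleftrightarrow> (f has_integral I) {c<..}"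
  by (rule has_integral_spike_set_eq) (auto intro: negligible_subset[OF negligible_sing[of c]])

lemma has_integral_Gamma_greaterThan:
  fixes s :: real
  assumes "s > 0"
  shows "((\<lambda>u. u powr (s - 1) * exp (- u)) has_integral Gamma s) {0<..}"
proof -
  have "((\<lambda>u. u powr (s - 1) * exp (- u)) has_integral Gamma s) {0..}"
    using Gamma_integral_real[OF assms] by (simp add: exp_minus divide_inverse)
  then show ?thesis
    by (simp only: has_integral_atLeast_iff_greaterThan)
qed

text \<open>
  The factor \<open>u\<close> in the hypothesis lowers the singularity \<open>u powr (s - 1)\<close> to \<open>u powr s \<le> 1 + u\<close>, so
  the integrand is dominated by a decaying exponential that does not depend on \<open>s\<close>.
\<close>

lemma gamma_integral_deviation:
  fixes h :: "real \<Rightarrow> real" and C c L s :: real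
  assumes h [measurable]: "h \<in> borel_measurable borel"
    and C: "C \<ge> 0" and c: "0 \<le> c" "c < 1"
    and bound: "\<And>u. u > 0 \<Longrightarrow> \<bar>h u - L\<bar> \<le> C * u * exp (c * u)"
    and s: "0 < s" "s \<le> 1"
  shows "(\<lambda>u. u powr (s - 1) * exp (- u) * h u) absolutely_integrable_on {0<..}"
    and "\<bar>integral {0<..} (\<lambda>u. u powr (s - 1) * exp (- u) * h u) - L * Gamma s\<bar> \<le> 4 * C / (1 - c)\<^sup>2"
proof -
  define \<delta> where "\<delta> = (1 - c) / 2"
  have \<delta>: "0 < \<delta>" "\<delta> \<le> 1" using c by (auto simp: \<delta>_def)
  define g where "g = (\<lambda>u::real. u powr (s - 1) * exp (- u))"
  define D where "D = (\<lambda>u. g u * (h u - L))"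
  have g: "(g has_integral Gamma s) {0<..}"
    unfolding g_def by (rule has_integral_Gamma_greaterThan[OF s(1)])
  have g_abs: "g absolutely_integrable_on {0<..}"
    using g by (intro nonnegative_absolutely_integrable_1) (auto simp: g_def)
  have "((\<lambda>u. exp (- \<delta> * u)) has_integral 1 / \<delta>) {0..}"
    using has_integral_exp_minus_to_infinity[OF \<delta>(1), of 0] by simp
  then have "((\<lambda>u. exp (- \<delta> * u)) has_integral 1 / \<delta>) {0<..}"
    by (simp only: has_integral_atLeast_iff_greaterThan)
  then have E: "((\<lambda>u. C / \<delta> * exp (- \<delta> * u)) has_integral C / \<delta> * (1 / \<delta>)) {0<..}"
    by (rule has_integral_mult_right)
  have le: "norm (D u) \<le> C / \<delta> * exp (- \<delta> * u)" if "u \<in> {0<..}" for u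
  proof -
    have u: "u > 0" using that by simp
    have "u powr s \<le> (1 + u) powr s"
      using u s by (intro powr_mono2) auto
    also have "\<dots> \<le> (1 + u) powr 1"
      using u s by (intro powr_mono) auto
    also have "\<dots> = 1 + u" using u by simp
    also have "\<dots> \<le> exp (\<delta> * u) / \<delta>"
      by (rule one_plus_le_exp_div[OF \<delta>])
    finally have us: "u powr s \<le> exp (\<delta> * u) / \<delta>" .
    have "norm (D u) = g u * \<bar>h u - L\<bar>"
      by (simp add: D_def g_def abs_mult)
    also have "\<dots> \<le> g u * (C * u * exp (c * u))"
      using bound[OF u] by (intro mult_left_mono) (auto simp: g_def)
    also have "\<dots> = C * u powr s * (exp (- u) * exp (c * u))"
      using u by (simp add: g_def powr_diff field_simps)
    also have "exp (- u) * exp (c * u) = exp (- 2 * \<delta> * u)"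
      by (simp add: \<delta>_def exp_add[symmetric] algebra_simps)
    also have "C * u powr s * exp (- 2 * \<delta> * u) \<le> C * (exp (\<delta> * u) / \<delta>) * exp (- 2 * \<delta> * u)"
      using us C by (intro mult_right_mono mult_left_mono) auto
    also have "\<dots> = C / \<delta> * (exp (\<delta> * u) * exp (- 2 * \<delta> * u))"
      by simp
    also have "exp (\<delta> * u) * exp (- 2 * \<delta> * u) = exp (- \<delta> * u)"
      by (simp add: exp_add[symmetric])
    finally show ?thesis .
  qed
  have D_abs: "D absolutely_integrable_on {0<..}"
  proof (rule measurable_bounded_by_integrable_imp_absolutely_integrable)
    have "D \<in> borel_measurable lborel"
      unfolding D_def g_def by measurable
    then show "D \<in> borel_measurable (lebesgue_on {0<..})"
      by (intro measurable_restrict_space1 measurable_completion)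
    show "(\<lambda>u. C / \<delta> * exp (- \<delta> * u)) integrable_on {0<..}"
      using E by blast
  qed (use le in auto)
  have split: "(\<lambda>u. u powr (s - 1) * exp (- u) * h u) = (\<lambda>u. D u + L * g u)"
    by (auto simp: D_def g_def algebra_simps)
  show "(\<lambda>u. u powr (s - 1) * exp (- u) * h u) absolutely_integrable_on {0<..}"
    unfolding split
    by (intro set_integral_add(1) D_abs set_integrable_mult_right g_abs)
  have "integral {0<..} (\<lambda>u. u powr (s - 1) * exp (- u) * h u) - L * Gamma s = integral {0<..} D"
  proof -
    have "((\<lambda>u. D u + L * g u) has_integral integral {0<..} D + L * Gamma s) {0<..}"
      using absolutely_integrable_on_def D_abs
      by (intro has_integral_add has_integral_mult_right g integrable_integral) blast
    then show ?thesis
      unfolding split by (simp add: integral_unique)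
  qed
  also have "\<bar>integral {0<..} D\<bar> \<le> C / \<delta> * (1 / \<delta>)"
  proof -
    have "norm (integral {0<..} D) \<le> integral {0<..} (\<lambda>u. C / \<delta> * exp (- \<delta> * u))"
      using D_abs E le
      by (intro integral_norm_bound_integral) (auto simp: absolutely_integrable_on_def)
    then show ?thesis
      using integral_unique[OF E] by simp
  qed
  also have "\<dots> = 4 * C / (1 - c)\<^sup>2"
    by (simp add: \<delta>_def power2_eq_square)
  finally show "\<bar>integral {0<..} (\<lambda>u. u powr (s - 1) * exp (- u) * h u) - L * Gamma s\<bar>
      \<le> 4 * C / (1 - c)\<^sup>2" .
qed

text \<open>
  The deviation from \<open>L\<close> is at most a constant times \<open>1 / Gamma s\<close>, and the reciprocal Gamma
  function is continuous and vanishes at \<open>0\<close>.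
\<close>

lemma gamma_mean_tendsto:
  fixes h :: "real \<Rightarrow> real" and C c L :: real
  assumes h: "h \<in> borel_measurable borel"
    and C: "C \<ge> 0" and c: "0 \<le> c" "c < 1"
    and bound: "\<And>u. u > 0 \<Longrightarrow> \<bar>h u - L\<bar> \<le> C * u * exp (c * u)"
  shows "((\<lambda>s. integral {0<..} (\<lambda>u. u powr (s - 1) * exp (- u) * h u) / Gamma s) \<longlongrightarrow> L)
           (at_right 0)"
proof -
  define I where "I = (\<lambda>s. integral {0<..} (\<lambda>u. u powr (s - 1) * exp (- u) * h u))"
  define K where "K = 4 * C / (1 - c)\<^sup>2"
  have "isCont rGamma (0 :: real)"
    using continuous_on_rGamma[of "UNIV :: real set"] by (simp add: continuous_on_eq_continuous_at)
  then have "(rGamma \<longlongrightarrow> (0 :: real)) (at_right 0)"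
    by (simp add: isCont_def filterlim_at_split)
  then have "((\<lambda>s. K * rGamma s) \<longlongrightarrow> 0) (at_right 0)"
    using tendsto_mult_right_zero by blast
  moreover have "\<forall>\<^sub>F s in at_right 0. norm (I s / Gamma s - L) \<le> K * rGamma s"
  proof -
    have "\<forall>\<^sub>F s in at_right (0::real). s \<in> {0<..<1}"
      by (rule eventually_at_right_real) simp
    then show ?thesis
    proof eventually_elim
      case (elim s)
      then have G: "Gamma s > 0" by (simp add: Gamma_real_pos)
      have "norm (I s / Gamma s - L) = \<bar>I s - L * Gamma s\<bar> / Gamma s"
        using G by (simp add: field_simps abs_divide)
      also have "\<dots> \<le> K / Gamma s"
        using gamma_integral_deviation(2)[OF h C c bound, of s] elim G
        by (intro divide_right_mono) (auto simp: I_def K_def)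
      finally show ?case
        by (simp add: rGamma_inverse_Gamma divide_inverse)
    qed
  qed
  ultimately have "((\<lambda>s. I s / Gamma s - L) \<longlongrightarrow> 0) (at_right 0)"
    by (rule Lim_null_comparison[rotated])
  then show ?thesis
    unfolding I_def by (rule LIM_zero_cancel)
qed

section \<open>The substitution\<close>

text \<open>
  Under \<open>u = t powr p - x powr p\<close> the power of \<open>1 + u / x powr p = (t / x) powr p\<close> equals
  \<open>(x / t) powr (p - 1)\<close>: it cancels \<open>t powr (p - 1)\<close> in the Jacobian and leaves the prefactor
  \<open>x powr (p - 1)\<close>. The integrability hypothesis is on the transformed side, because the substitution
  theorem transfers integrability and the value together.
\<close>

lemma V_eq_gamma_mean:
  fixes p x m :: real
  assumes p: "p > 0" and x: "x > 0"
    and int: "(\<lambda>u. u powr m * exp (- u) * (1 + u / x powr p) powr (1 / p - 1))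
                absolutely_integrable_on {0<..}"
  shows "x powr (p - 1) * V m p x =
         integral {0<..} (\<lambda>u. u powr m * exp (- u) * (1 + u / x powr p) powr (1 / p - 1)) / Gamma (m + 1)"
proof -
  define a where "a = x powr p"
  define F where "F = (\<lambda>u. u powr m * exp (- u) * (1 + u / a) powr (1 / p - 1))"
  define f where "f = (\<lambda>t. (t powr p - a) powr m * exp (- (t powr p)))"
  define G where "G = (\<lambda>t. t powr p - a)"
  define G' where "G' = (\<lambda>t. p * t powr (p - 1))"
  define K where "K = p * exp a * x powr (p - 1)"
  have a: "a > 0" using x by (simp add: a_def)
  have K: "K > 0" using p x by (simp add: K_def)
  have image: "G ` {x<..} = {0<..}"
  proof (intro equalityI subsetI)
    fix u assume "u \<in> G ` {x<..}"
    then show "u \<in> {0<..}"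
      using p x by (auto simp: G_def a_def intro!: powr_less_mono2)
  next
    fix u :: real assume u: "u \<in> {0<..}"
    define t where "t = (a + u) powr (1 / p)"
    have "a powr (1 / p) < t"
      unfolding t_def using u a p by (intro powr_less_mono2) auto
    moreover have "a powr (1 / p) = x"
      using p x by (simp add: a_def powr_powr)
    ultimately have "t > x" by simp
    moreover have "G t = u"
      using u a p by (simp add: G_def t_def powr_powr)
    ultimately show "u \<in> G ` {x<..}" by force
  qed
  have inj: "inj_on G {x<..}"
  proof (rule inj_onI)
    fix t t' assume "t \<in> {x<..}" "t' \<in> {x<..}" "G t = G t'"
    then show "t = t'"
      using p x powr_less_mono2[of p t t'] powr_less_mono2[of p t' t]
      by (cases t t' rule: linorder_cases) (auto simp: G_def)
  qed
  have der: "(G has_field_derivative G' t) (at t within {x<..})" if "t \<in> {x<..}" for t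
    using that x by (auto simp: G_def G'_def intro!: derivative_eq_intros)
  have eq: "\<bar>G' t\<bar> * F (G t) = K * f t" if "t \<in> {x<..}" for t
  proof -
    have t: "t > 0" using that x by simp
    have "1 + G t / a = (t / x) powr p"
      using a x t by (simp add: G_def field_simps a_def powr_divide)
    then have "(1 + G t / a) powr (1 / p - 1) = (t / x) powr (1 - p)"
      using p by (simp add: powr_powr algebra_simps)
    also have "\<dots> = x powr (p - 1) / t powr (p - 1)"
      using x t powr_minus_divide[of t "p - 1"] powr_minus_divide[of x "p - 1"]
      by (simp add: powr_divide)
    finally have q: "(1 + G t / a) powr (1 / p - 1) = x powr (p - 1) / t powr (p - 1)" .
    have e: "exp (- G t) = exp a * exp (- (t powr p))"
      by (simp add: G_def exp_add[symmetric])
    show ?thesis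
      unfolding F_def q e using t p by (simp add: K_def f_def G_def G'_def abs_mult)
  qed
  have "F absolutely_integrable_on G ` {x<..} \<and> integral (G ` {x<..}) F = integral {0<..} F"
    using int by (simp add: image F_def a_def)
  then have "(\<lambda>t. \<bar>G' t\<bar> * F (G t)) absolutely_integrable_on {x<..} \<and>
      integral {x<..} (\<lambda>t. \<bar>G' t\<bar> * F (G t)) = integral {0<..} F"
    using has_absolute_integral_change_of_variables_1'[OF _ der inj, where f = F] by auto
  moreover have "(\<lambda>t. \<bar>G' t\<bar> * F (G t)) absolutely_integrable_on {x<..} \<longleftrightarrow>
      (\<lambda>t. K * f t) absolutely_integrable_on {x<..}"
    using eq by (intro set_integrable_cong) auto
  moreover have "integral {x<..} (\<lambda>t. \<bar>G' t\<bar> * F (G t)) = integral {x<..} (\<lambda>t. K * f t)"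
    using eq by (intro integral_cong) auto
  ultimately have Kf: "(\<lambda>t. K * f t) absolutely_integrable_on {x<..}"
    and I: "K * integral {x<..} f = integral {0<..} F"
    by auto
  have "f absolutely_integrable_on {x<..}"
    using Kf K by (simp add: set_integrable_mult_right_iff)
  moreover have "(\<lambda>t. indicator {x<..} t *\<^sub>R f t) \<in> borel_measurable lborel"
    unfolding f_def by measurable
  ultimately have "set_integrable lborel {x<..} f"
    unfolding set_integrable_def using integrable_completion by blast
  then have "(LBINT t:{x<..}. f t) = integral {x<..} f"
    by (rule set_borel_integral_eq_integral)
  then have "x powr (p - 1) * V m p x = K * integral {x<..} f / Gamma (m + 1)"
    by (simp add: V_def f_def K_def a_def)
  then show ?thesis
    unfolding I by (simp add: F_def a_def)
qed

section \<open>The limit\<close>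

theorem proposition1:
  fixes p x :: real
  assumes "p > 0" and "x > 0"
  shows "((\<lambda>m. x powr (p - 1) * V m p x) \<longlongrightarrow> 1) (at_right (-1))"
proof -
  define h where "h = (\<lambda>u. (1 + u / x powr p) powr (1 / p - 1))"
  have h: "h \<in> borel_measurable borel"
    unfolding h_def by measurable
  \<comment> \<open>Any rate strictly between \<open>0\<close> and \<open>1\<close> would do in place of \<open>1/2\<close>.\<close>
  obtain C where C: "C \<ge> 0" and bound: "\<And>u. u > 0 \<Longrightarrow> \<bar>h u - 1\<bar> \<le> C * u * exp (1/2 * u)"
    using powr_deviation_le_exp[of "x powr p" "1/2" "1 / p - 1"] assms(2)
    unfolding h_def by auto
  have "((\<lambda>s. integral {0<..} (\<lambda>u. u powr (s - 1) * exp (- u) * h u) / Gamma s) \<longlongrightarrow> 1) (at_right 0)"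
    by (rule gamma_mean_tendsto[OF h C _ _ bound]) auto
  then have "((\<lambda>m. integral {0<..} (\<lambda>u. u powr m * exp (- u) * h u) / Gamma (m + 1)) \<longlongrightarrow> 1)
      (at_right (- 1))"
    by (subst at_right_to_0) (simp add: filterlim_filtermap)
  moreover have "\<forall>\<^sub>F m in at_right (- 1).
      integral {0<..} (\<lambda>u. u powr m * exp (- u) * h u) / Gamma (m + 1) = x powr (p - 1) * V m p x"
  proof -
    have "\<forall>\<^sub>F m in at_right (-1::real). m \<in> {-1<..<0}"
      by (rule eventually_at_right_real) simp
    then show ?thesis
    proof eventually_elim
      case (elim m)
      have "(\<lambda>u. u powr (m + 1 - 1) * exp (- u) * h u) absolutely_integrable_on {0<..}"
        by (rule gamma_integral_deviation(1)[OF h C _ _ bound]) (use elim in auto)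
      then show ?case
        using V_eq_gamma_mean[OF assms, of m] by (simp add: h_def)
    qed
  qed
  ultimately show ?thesis
    by (rule Lim_transform_eventually)
qed

end
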